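(* Let $\varphi:R\rightarrow S$ be a ring homomorphism. (1) If $\varphi$ is surjective, $I$ is a quasi sdf-absorbing ideal of $R$, and $\ker\varphi\subseteq\sqrt{I}$, then $\varphi(I)$ is a quasi sdf-absorbing ideal of $S$. (2) If $J$ is a quasi sdf-absorbing ideal of $S$, then $\varphi^{-1}(J)$ is a quasi sdf-absorbing ideal of $R$.
   Context: All rings are commutative with identity. An ideal $I$ of a ring $R$ is called sdf-absorbing if for all non-zero $a,b\in R$, $a^{2}-b^{2}\in I$ implies $a-b\in I$ or $a+b\in I$. A proper ideal $I$ of $R$ is called quasi sdf-absorbing if its radical $\sqrt{I}$ is an sdf-absorbing ideal of $R$. *)

theory Defs
  imports "HOL-Algebra.RingHom"
begin

definition ideal_radical :: "('a, 'm) ring_scheme \<Rightarrow> 'a set \<Rightarrow> 'a set" where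
  "ideal_radical R I = {r \<in> carrier R. \<exists>n::nat. n > 0 \<and> r [^]\<^bsub>R\<^esub> n \<in> I}"

text \<open>An sdf-absorbing ideal is not required to be proper; properness is only imposed
  on quasi sdf-absorbing ideals.\<close>

definition sdf_absorbing :: "('a, 'm) ring_scheme \<Rightarrow> 'a set \<Rightarrow> bool" where
  "sdf_absorbing R I \<longleftrightarrow> ideal I R \<and>
    (\<forall>a \<in> carrier R - {\<zero>\<^bsub>R\<^esub>}. \<forall>b \<in> carrier R - {\<zero>\<^bsub>R\<^esub>}.
      (a [^]\<^bsub>R\<^esub> (2::nat)) \<ominus>\<^bsub>R\<^esub> (b [^]\<^bsub>R\<^esub> (2::nat)) \<in> I \<longrightarrow>
        a \<ominus>\<^bsub>R\<^esub> b \<in> I \<or> a \<oplus>\<^bsub>R\<^esub> b \<in> I)"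

definition quasi_sdf_absorbing :: "('a, 'm) ring_scheme \<Rightarrow> 'a set \<Rightarrow> bool" where
  "quasi_sdf_absorbing R I \<longleftrightarrow>
    ideal I R \<and> I \<noteq> carrier R \<and> sdf_absorbing R (ideal_radical R I)"

end

theory Submission
  imports Defs "HOL-Algebra.QuotRing"
begin

text \<open>Forming the radical commutes with taking preimages, and also with taking images under a
  surjection whose kernel lies in the radical, so both parts reduce to transporting sdf-absorption of
  a radical ideal. In the image direction, an ideal containing the kernel is the preimage of its
  image, and lifts of non-zero elements are non-zero. In the preimage direction, non-zero elements
  may be mapped to zero; but if, say, \<open>\<phi> a = 0\<close>, then \<open>\<phi> a ^ 2 - \<phi> b ^ 2\<close> being in a radical ideal
  forces \<open>\<phi> b\<close>, and hence \<open>\<phi> (a + b)\<close>, into it.\<close>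

section \<open>Elementary properties of the radical\<close>

lemma ideal_radicalI:
  assumes "r \<in> carrier R" "n > 0" "r [^]\<^bsub>R\<^esub> (n::nat) \<in> I"
  shows "r \<in> ideal_radical R I"
  using assms by (auto simp: ideal_radical_def)

lemma ideal_radicalE:
  assumes "r \<in> ideal_radical R I"
  obtains n :: nat where "r \<in> carrier R" "n > 0" "r [^]\<^bsub>R\<^esub> n \<in> I"
  using assms by (auto simp: ideal_radical_def)

text \<open>Exponents multiply: \<open>(r ^ n) ^ m = r ^ (n * m)\<close>. The case
  \<open>n = 2\<close> makes radicals semiprime; the general case extracts roots when radicals are
  pushed forward.\<close>

lemma (in ring) ideal_radical_pow:
  assumes "r \<in> carrier R" "n > 0" "r [^] (n::nat) \<in> ideal_radical R I"
  shows "r \<in> ideal_radical R I"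
proof -
  obtain m :: nat where "m > 0" "(r [^] n) [^] m \<in> I"
    using assms(3) by (rule ideal_radicalE)
  then show ?thesis
    using assms by (intro ideal_radicalI[of _ _ "n * m"]) (auto simp: nat_pow_pow)
qed

lemma (in ideal) ideal_subset_radical: "I \<subseteq> ideal_radical R I"
proof
  fix x
  assume "x \<in> I"
  then show "x \<in> ideal_radical R I"
    by (intro ideal_radicalI[of _ _ 1]) auto
qed

section \<open>Ideals and radicals along a ring homomorphism\<close>

context ring_hom_ring
begin

lemma hom_minus: "x \<in> carrier R \<Longrightarrow> y \<in> carrier R \<Longrightarrow> h (x \<ominus> y) = h x \<ominus>\<^bsub>S\<^esub> h y"
  by (simp add: a_minus_def)

lemma ideal_image:
  assumes surj: "h ` carrier R = carrier S" and I: "ideal I R"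
  shows "ideal (h ` I) S"
proof -
  interpret I: ideal I R by (fact I)
  have mult: "s \<otimes>\<^bsub>S\<^esub> x \<in> h ` I" "x \<otimes>\<^bsub>S\<^esub> s \<in> h ` I"
    if x: "x \<in> h ` I" and s: "s \<in> carrier S" for x s
  proof -
    obtain i where i: "i \<in> I" "x = h i"
      using x by auto
    \<comment> \<open>Surjectivity enters here: an arbitrary multiplier from \<open>S\<close> must
      be lifted to \<open>R\<close> before the absorption property of \<open>I\<close>
      applies.\<close>
    obtain r where r: "r \<in> carrier R" "s = h r"
      using s surj by blast
    have "h (r \<otimes> i) = s \<otimes>\<^bsub>S\<^esub> x" "h (i \<otimes> r) = x \<otimes>\<^bsub>S\<^esub> s"
      using i r I.Icarr by simp_all
    moreover have "r \<otimes> i \<in> I" "i \<otimes> r \<in> I"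
      using I.I_l_closed I.I_r_closed i r by simp_all
    ultimately show "s \<otimes>\<^bsub>S\<^esub> x \<in> h ` I" "x \<otimes>\<^bsub>S\<^esub> s \<in> h ` I"
      by (metis imageI)+
  qed
  have sub: "subgroup (h ` I) (add_monoid S)"
  proof (rule S.add.subgroupI)
    show "h ` I \<subseteq> carrier S" "h ` I \<noteq> {}"
      using I.Icarr I.zero_closed by (blast intro: hom_closed)+
    show "\<ominus>\<^bsub>S\<^esub> x \<in> h ` I" if x: "x \<in> h ` I" for x
    proof -
      obtain i where i: "i \<in> I" "x = h i"
        using x by auto
      then have "h (\<ominus> i) = \<ominus>\<^bsub>S\<^esub> x"
        using I.Icarr by simp
      then show ?thesis
        using i I.a_inv_closed by (metis imageI)
    qed
    show "x \<oplus>\<^bsub>S\<^esub> y \<in> h ` I" if xy: "x \<in> h ` I" "y \<in> h ` I" for x y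
    proof -
      obtain i j where ij: "i \<in> I" "x = h i" "j \<in> I" "y = h j"
        using xy by auto
      then have "h (i \<oplus> j) = x \<oplus>\<^bsub>S\<^esub> y"
        using I.Icarr by simp
      then show ?thesis
        using ij I.a_closed by (metis imageI)
    qed
  qed
  show ?thesis
    by (rule idealI[OF S.ring_axioms sub mult])
qed

text \<open>If \<open>h x = h i\<close> with \<open>i\<close> in \<open>I\<close>, then
  \<open>x - i\<close> lies in the kernel, hence in \<open>K\<close>, and so does
  \<open>x = (x - i) + i\<close>. Keeping \<open>I\<close> and \<open>K\<close> apart allows
  \<open>K\<close> to be the radical of \<open>I\<close>, where the kernel is only known to lie in
  the radical; the choice \<open>I = K\<close> says that \<open>K\<close> is the full preimage of
  its image.\<close>

lemma hom_mem_image_imp_mem: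
  assumes K: "ideal K R" and ker: "a_kernel R S h \<subseteq> K" and "I \<subseteq> K"
    and x: "x \<in> carrier R" and hx: "h x \<in> h ` I"
  shows "x \<in> K"
proof -
  interpret K: ideal K R by (fact K)
  obtain i where i: "i \<in> I" "h x = h i"
    using hx by auto
  have iK: "i \<in> K" "i \<in> carrier R"
    using i \<open>I \<subseteq> K\<close> K.Icarr by auto
  have "h (x \<ominus> i) = \<zero>\<^bsub>S\<^esub>"
    using x iK i by (simp only: hom_minus S.minus_eq S.r_neg hom_closed)
  then have "x \<ominus> i \<in> a_kernel R S h"
    unfolding a_kernel_def' using R.minus_closed[OF x iK(2)] by (intro CollectI conjI)
  then have "x \<ominus> i \<in> K"
    using ker by blast
  then have "(x \<ominus> i) \<oplus> i \<in> K"
    using iK(1) by (rule K.a_closed)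
  also have "(x \<ominus> i) \<oplus> i = x"
    using x iK by (simp add: R.minus_eq R.a_assoc R.l_neg)
  finally show ?thesis .
qed

text \<open>Since \<open>h (r ^ n) = (h r) ^ n\<close>, the same exponent is a witness on both
  sides.\<close>

lemma ideal_radical_vimage:
  "ideal_radical R {r \<in> carrier R. h r \<in> J} = {r \<in> carrier R. h r \<in> ideal_radical S J}"
  by (auto simp: ideal_radical_def hom_nat_pow)

text \<open>Multiplication need not commute in this locale, so that the radical is an ideal is a
  hypothesis; in the application it is part of sdf-absorption.\<close>

lemma ideal_radical_image:
  assumes surj: "h ` carrier R = carrier S" and I: "ideal I R"
    and rad: "ideal (ideal_radical R I) R" and ker: "a_kernel R S h \<subseteq> ideal_radical R I"
  shows "ideal_radical S (h ` I) = h ` ideal_radical R I"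
proof (intro equalityI subsetI)
  fix s
  assume "s \<in> ideal_radical S (h ` I)"
  then obtain n :: nat where n: "s \<in> carrier S" "n > 0" "s [^]\<^bsub>S\<^esub> n \<in> h ` I"
    by (rule ideal_radicalE)
  then obtain r where r: "r \<in> carrier R" "s = h r"
    using surj by blast
  \<comment> \<open>The power \<open>r ^ n\<close> agrees with an element of \<open>I\<close> only
    up to the kernel, so it is placed in the radical rather than in \<open>I\<close>; taking an
    \<open>n\<close>-th root then stays inside the radical.\<close>
  have "r [^] n \<in> ideal_radical R I"
  proof (rule hom_mem_image_imp_mem[OF rad ker ideal.ideal_subset_radical[OF I]])
    show "r [^] n \<in> carrier R" "h (r [^] n) \<in> h ` I"
      using n r by (simp_all add: hom_nat_pow)
  qed
  then show "s \<in> h ` ideal_radical R I"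
    using R.ideal_radical_pow[OF r(1) n(2)] r(2) by blast
next
  fix s
  assume "s \<in> h ` ideal_radical R I"
  then obtain r where r: "r \<in> ideal_radical R I" "s = h r"
    by auto
  then obtain n :: nat where n: "r \<in> carrier R" "n > 0" "r [^] n \<in> I"
    by (auto elim: ideal_radicalE)
  then have "s [^]\<^bsub>S\<^esub> n \<in> h ` I"
    using r by (simp flip: hom_nat_pow)
  then show "s \<in> ideal_radical S (h ` I)"
    using n r by (intro ideal_radicalI) simp_all
qed

section \<open>Transport of sdf-absorption\<close>

lemma sdf_absorbing_image:
  assumes surj: "h ` carrier R = carrier S" and K: "sdf_absorbing R K"
    and ker: "a_kernel R S h \<subseteq> K"
  shows "sdf_absorbing S (h ` K)"
proof -
  have idK: "ideal K R"
    using K by (simp add: sdf_absorbing_def)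
  have "a \<ominus>\<^bsub>S\<^esub> b \<in> h ` K \<or> a \<oplus>\<^bsub>S\<^esub> b \<in> h ` K"
    if ab: "a \<in> carrier S" "a \<noteq> \<zero>\<^bsub>S\<^esub>" "b \<in> carrier S" "b \<noteq> \<zero>\<^bsub>S\<^esub>"
      and mem: "a [^]\<^bsub>S\<^esub> (2::nat) \<ominus>\<^bsub>S\<^esub> b [^]\<^bsub>S\<^esub> (2::nat) \<in> h ` K" for a b
  proof -
    obtain x y where xy: "x \<in> carrier R" "a = h x" "y \<in> carrier R" "b = h y"
      using ab surj by blast
    have "x \<noteq> \<zero>" "y \<noteq> \<zero>"
      using ab xy by auto
    have "h (x [^] (2::nat) \<ominus> y [^] (2::nat)) \<in> h ` K"
      using mem xy by (simp add: hom_minus hom_nat_pow)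
    then have "x [^] (2::nat) \<ominus> y [^] (2::nat) \<in> K"
      using hom_mem_image_imp_mem[OF idK ker subset_refl] xy by simp
    then have "x \<ominus> y \<in> K \<or> x \<oplus> y \<in> K"
      using K xy \<open>x \<noteq> \<zero>\<close> \<open>y \<noteq> \<zero>\<close> by (simp add: sdf_absorbing_def)
    then have "h (x \<ominus> y) \<in> h ` K \<or> h (x \<oplus> y) \<in> h ` K"
      by blast
    then show ?thesis
      using xy by (simp add: hom_minus)
  qed
  then show ?thesis
    using ideal_image[OF surj idK] by (simp add: sdf_absorbing_def)
qed

text \<open>The radical of \<open>J\<close> is the intended \<open>K\<close>. Semiprimeness is the
  one feature of radicals that the argument uses, and it serves the case of a non-zero element with
  zero image.\<close>

lemma sdf_absorbing_vimage:
  assumes K: "sdf_absorbing S K"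
    and semiprime: "\<And>x. x \<in> carrier S \<Longrightarrow> x [^]\<^bsub>S\<^esub> (2::nat) \<in> K \<Longrightarrow> x \<in> K"
  shows "sdf_absorbing R {r \<in> carrier R. h r \<in> K}"
proof -
  have idK: "ideal K S"
    using K by (simp add: sdf_absorbing_def)
  interpret K: ideal K S by (fact idK)
  have sq0: "\<zero>\<^bsub>S\<^esub> [^]\<^bsub>S\<^esub> (2::nat) = \<zero>\<^bsub>S\<^esub>"
    by (simp add: S.nat_pow_zero)
  \<comment> \<open>Absorption without the non-zero restriction, so that it can be applied to
    \<open>h a\<close> and \<open>h b\<close> directly.\<close>
  have absorb: "a \<ominus>\<^bsub>S\<^esub> b \<in> K \<or> a \<oplus>\<^bsub>S\<^esub> b \<in> K"
    if ab: "a \<in> carrier S" "b \<in> carrier S"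
      and mem: "a [^]\<^bsub>S\<^esub> (2::nat) \<ominus>\<^bsub>S\<^esub> b [^]\<^bsub>S\<^esub> (2::nat) \<in> K" for a b
  proof -
    consider "a = \<zero>\<^bsub>S\<^esub>" | "b = \<zero>\<^bsub>S\<^esub>" | "a \<noteq> \<zero>\<^bsub>S\<^esub>" "b \<noteq> \<zero>\<^bsub>S\<^esub>"
      by blast
    then show ?thesis
    proof cases
      case 1
      have "\<ominus>\<^bsub>S\<^esub> (b [^]\<^bsub>S\<^esub> (2::nat)) \<in> K"
        using mem ab 1 by (simp add: sq0 S.minus_eq)
      then have "b [^]\<^bsub>S\<^esub> (2::nat) \<in> K"
        using K.a_inv_closed ab by fastforce
      then have "b \<in> K"
        using semiprime ab by blast
      then show ?thesis
        using ab 1 by simp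
    next
      case 2
      have "a [^]\<^bsub>S\<^esub> (2::nat) \<in> K"
        using mem ab 2 by (simp add: sq0 S.minus_eq)
      then have "a \<in> K"
        using semiprime ab by blast
      then show ?thesis
        using ab 2 by (simp add: S.minus_eq)
    next
      case 3
      then show ?thesis
        using K ab mem by (simp add: sdf_absorbing_def)
    qed
  qed
  show ?thesis
    unfolding sdf_absorbing_def
    using ideal_vimage[OF idK] absorb by (simp add: hom_minus hom_nat_pow)
qed

section \<open>Properness, and the two halves of the theorem\<close>

lemma quasi_sdf_absorbing_image:
  assumes surj: "h ` carrier R = carrier S" and I: "quasi_sdf_absorbing R I"
    and ker: "a_kernel R S h \<subseteq> ideal_radical R I"
  shows "quasi_sdf_absorbing S (h ` I)"
proof -
  have idI: "ideal I R" and proper: "I \<noteq> carrier R" and sdf: "sdf_absorbing R (ideal_radical R I)"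
    using I by (simp_all add: quasi_sdf_absorbing_def)
  have rad: "ideal (ideal_radical R I) R"
    using sdf by (simp add: sdf_absorbing_def)
  have "h ` I \<noteq> carrier S"
  proof
    assume "h ` I = carrier S"
    then have "h \<one> \<in> h ` I"
      by simp
    \<comment> \<open>The kernel condition first gives \<open>1\<close> in the radical only; as
      every power of \<open>1\<close> is \<open>1\<close>, it then lies in \<open>I\<close>
      itself.\<close>
    then have "\<one> \<in> ideal_radical R I"
      using hom_mem_image_imp_mem[OF rad ker ideal.ideal_subset_radical[OF idI]] by blast
    then have "\<one> \<in> I"
      by (auto elim: ideal_radicalE)
    then show False
      using ideal.one_imp_carrier[OF idI] proper by blast
  qed
  then show ?thesis
    using ideal_image[OF surj idI] sdf_absorbing_image[OF surj sdf ker]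
    by (simp add: quasi_sdf_absorbing_def ideal_radical_image[OF surj idI rad ker])
qed

lemma quasi_sdf_absorbing_vimage:
  assumes J: "quasi_sdf_absorbing S J"
  shows "quasi_sdf_absorbing R {r \<in> carrier R. h r \<in> J}"
proof -
  have idJ: "ideal J S" and proper: "J \<noteq> carrier S" and sdf: "sdf_absorbing S (ideal_radical S J)"
    using J by (simp_all add: quasi_sdf_absorbing_def)
  have "\<one>\<^bsub>S\<^esub> \<notin> J"
    using ideal.one_imp_carrier[OF idJ] proper by blast
  then have "\<one> \<notin> {r \<in> carrier R. h r \<in> J}"
    by simp
  then have "{r \<in> carrier R. h r \<in> J} \<noteq> carrier R"
    using R.one_closed by blast
  \<comment> \<open>The radical of \<open>J\<close> contains every element whose square it contains,
    which is the semiprimeness condition.\<close>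
  moreover have "sdf_absorbing R {r \<in> carrier R. h r \<in> ideal_radical S J}"
    by (intro sdf_absorbing_vimage[OF sdf]) (rule S.ideal_radical_pow[of _ 2]; simp)
  ultimately show ?thesis
    using ideal_vimage[OF idJ] by (simp add: quasi_sdf_absorbing_def ideal_radical_vimage)
qed

end

theorem theorem3p1:
  fixes R :: "('a, 'm) ring_scheme" and S :: "('b, 'n) ring_scheme"
    and \<phi> :: "'a \<Rightarrow> 'b"
  assumes "cring R" and "cring S" and "\<phi> \<in> ring_hom R S"
  shows "(\<forall>I. \<phi> ` carrier R = carrier S \<and> quasi_sdf_absorbing R I \<and>
              a_kernel R S \<phi> \<subseteq> ideal_radical R I
            \<longrightarrow> quasi_sdf_absorbing S (\<phi> ` I)) \<and>
         (\<forall>J. quasi_sdf_absorbing S J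
            \<longrightarrow> quasi_sdf_absorbing R {r \<in> carrier R. \<phi> r \<in> J})"
proof -
  interpret ring_hom_ring R S \<phi>
    using assms by (intro ring_hom_ringI2 cring.axioms(1))
  show ?thesis
    using quasi_sdf_absorbing_image quasi_sdf_absorbing_vimage by blast
qed

end
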